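(* Let $\mathbb K$ be the base ring, $(U,V)$ a linear set over $\mathbb K$, $N=\{a_1,\dots,a_n\}\subset\mathbb N$ (ordered, $a_1<\dots<a_n$) and $\alpha\subset N$. Define the $\alpha$-stair $S=S(\alpha)$, given by the following $n$ subsets $S_1,\dots,S_n\subset N$: $$S_i=\{a_i\}\cup\bigl(\alpha\setminus\{a_1,\dots,a_{i-1}\}\bigr)=\{a_j\mid j=i\ \text{or}\ (j>i\ \text{and}\ a_j\in\alpha)\}.$$ Then the vertex set $\mathsf G^{\alpha;N}U$ is given by $$\mathsf G^{\alpha;N}U=U^\alpha\times_{0^{\alpha\setminus\{a_1\}}}0^{S_1}\times_{0^{S_1\cap S_2}}0^{S_2}\times\dots\times_{0^{S_{n-1}\cap S_n}}0^{S_n}.$$ In particular, for $U=0$, we get the vertex sets of a point: $$\mathsf G^{\alpha;N}0=0^\alpha\times_{0^{\alpha\setminus\{a_1\}}}0^{S_1}\times_{0^{S_1\cap S_2}}0^{S_2}\times\dots\times_{0^{S_{n-1}\cap S_n}}0^{S_n}.$$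
   Context: A linear set is a pair $(U,V)$ with $V$ a $\mathbb K$-module (scalars written on the right) and $U\subset V$; $0$ denotes the linear set $(\{0\},\{0\})$. For $X$ a subset of a $\mathbb K$-module $E$ put $X^{\{k\}}=\{(x,v,t)\in E^2\times\mathbb K:x\in X,\ x+vt\in X\}$ ($k$ is only a label). The vertex sets $\mathsf G^{\alpha;N}U$ are defined recursively by $\mathsf G^{\emptyset;\emptyset}U=U$ and, for $N'=N\setminus\{a_n\}$: $\mathsf G^{\alpha;N}U=\mathsf G^{\alpha;N'}U\times\mathbb K$ if $a_n\notin\alpha$, and $\mathsf G^{\alpha;N}U=(\mathsf G^{\alpha\setminus\{a_n\};N'}U)^{\{a_n\}}$ if $a_n\in\alpha$. For a finite ordered set $A=\{b_1<\dots<b_k\}\subset\mathbb N$, $U^A=\mathsf G^{A;A}U=(\dots(U^{\{b_1\}})^{\{b_2\}}\dots)^{\{b_k\}}$. Affine coordinates: elements of $U^A$ are written $\bigl((v_\gamma)_{\gamma\subset A},(t_\gamma)_{\emptyset\ne\gamma\subset A}\bigr)$ with $v_\gamma\in V$, $t_\gamma\in\mathbb K$: passing from $U^{A'}$, $A'=A\setminus\{b_k\}$, to $U^A$, in a triple $(x,v,t)$ the component $x$ carries the coordinates indexed by $\gamma\subset A'$, $v$ carries those indexed by $\gamma\cup\{b_k\}$, and $t=t_{\{b_k\}}$. The same labelling is used for $\mathsf G^{\alpha;N}U$ (a new factor $\mathbb K$ at step $a_j$ has coordinate $t_{\{a_j\}}$). In particular $0^A\cong\mathbb K^{2^{|A|}-1}$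 with coordinates $(t_\gamma)_{\emptyset\ne\gamma\subset A}$, and $0^\emptyset$ is a point. The fibre products are formed with the canonical maps: $U^A\to0^A$ forgets all $v_\gamma$, and for $B\subset A$ the map $0^A\to0^B$ restricts $(t_\gamma)$ to $\gamma\subset B$; the equality is understood via the identification of coordinates.
   Formalization: If a_1 ∈ α, then S_1 = α and the printed fibre product over 0^{α∖{a_1}} is too large (N = α = {a_1}, U = 0 gives K² instead of K); there, entries t_γ with equal labels in different factors are additionally required to be equal. For a_1 ∉ α the claim is proved as printed. *)

theory Defs
  imports Main "HOL-Library.FuncSet"
begin

text \<open>Right modules, on a carrier set, over a unital ring that need be neither commutative nor
  nontrivial (class \<^class>\<open>ring_1\<close> would exclude the zero ring).\<close>

locale right_module =
  fixes V :: "'v::ab_group_add set"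
    and sc :: "'v \<Rightarrow> 'k::{ring,monoid_mult} \<Rightarrow> 'v"
  assumes zero_closed: "0 \<in> V"
    and add_closed: "x \<in> V \<Longrightarrow> y \<in> V \<Longrightarrow> x + y \<in> V"
    and uminus_closed: "x \<in> V \<Longrightarrow> - x \<in> V"
    and sc_closed: "x \<in> V \<Longrightarrow> sc x t \<in> V"
    and sc_add_left: "x \<in> V \<Longrightarrow> y \<in> V \<Longrightarrow> sc (x + y) t = sc x t + sc y t"
    and sc_add_right: "x \<in> V \<Longrightarrow> sc x (s + t) = sc x s + sc x t"
    and sc_assoc: "x \<in> V \<Longrightarrow> sc (sc x s) t = sc x (s * t)"
    and sc_one: "x \<in> V \<Longrightarrow> sc x 1 = x"

type_synonym 'a lset = "'a set \<times> 'a set"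

definition linear_set :: "('v::ab_group_add \<Rightarrow> 'k::{ring,monoid_mult} \<Rightarrow> 'v) \<Rightarrow> 'v lset \<Rightarrow> bool" where
  "linear_set sc P \<longleftrightarrow> right_module (snd P) sc \<and> fst P \<subseteq> snd P"

definition zero_lset :: "'v::ab_group_add lset" where
  "zero_lset = ({0}, {0})"

text \<open>The sets \<open>G\<^sup>\<alpha>\<^sup>;\<^sup>N U\<close> are built by iterating \<open>X \<mapsto> X \<times> K\<close> and \<open>X \<mapsto> X\<^sup>{\<^sup>k\<^sup>}\<close>; the following type
  holds the nested pairs \<open>(x, t)\<close> and triples \<open>(x, v, t)\<close> of all shapes at once. The module operations
  are componentwise, with \<open>K\<close> a right module over itself; they are only meant for arguments
  of equal shape.\<close>

datatype ('v, 'k) vertex =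
    Base 'v
  | Ext "('v, 'k) vertex" 'k
  | Tri "('v, 'k) vertex" "('v, 'k) vertex" 'k

fun vadd :: "('v::ab_group_add, 'k::{ring,monoid_mult}) vertex \<Rightarrow> ('v, 'k) vertex \<Rightarrow> ('v, 'k) vertex" where
  "vadd (Base u) (Base u') = Base (u + u')"
| "vadd (Ext x t) (Ext x' t') = Ext (vadd x x') (t + t')"
| "vadd (Tri x v t) (Tri x' v' t') = Tri (vadd x x') (vadd v v') (t + t')"
| "vadd _ _ = undefined"

fun vscale :: "('v::ab_group_add \<Rightarrow> 'k::{ring,monoid_mult} \<Rightarrow> 'v) \<Rightarrow>
    ('v, 'k) vertex \<Rightarrow> 'k \<Rightarrow> ('v, 'k) vertex" where
  "vscale sc (Base u) s = Base (sc u s)"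
| "vscale sc (Ext x t) s = Ext (vscale sc x s) (t * s)"
| "vscale sc (Tri x v t) s = Tri (vscale sc x s) (vscale sc v s) (t * s)"

text \<open>A pair \<open>(X, E)\<close> is a subset together with its ambient module, so each step
  also updates the ambient module.\<close>

definition times_K :: "('v, 'k) vertex lset \<Rightarrow> ('v, 'k) vertex lset" where
  "times_K = (\<lambda>(X, E). ({Ext x t | x t. x \<in> X}, {Ext x t | x t. x \<in> E}))"

definition brace :: "('v::ab_group_add \<Rightarrow> 'k::{ring,monoid_mult} \<Rightarrow> 'v) \<Rightarrow>
    ('v, 'k) vertex lset \<Rightarrow> ('v, 'k) vertex lset" where
  "brace sc = (\<lambda>(X, E).
     ({Tri x v t | x v t. x \<in> E \<and> v \<in> E \<and> x \<in> X \<and> vadd x (vscale sc v t) \<in> X},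
      {Tri x v t | x v t. x \<in> E \<and> v \<in> E}))"

text \<open>Finite ordered sets are processed from their largest element downwards, i.e. as the
  list \<open>[a\<^sub>n, \<dots>, a\<^sub>1]\<close>.\<close>

definition desc :: "nat set \<Rightarrow> nat list" where
  "desc N = rev (sorted_list_of_set N)"

fun G_list :: "('v::ab_group_add \<Rightarrow> 'k::{ring,monoid_mult} \<Rightarrow> 'v) \<Rightarrow> nat set \<Rightarrow> nat list \<Rightarrow>
    'v lset \<Rightarrow> ('v, 'k) vertex lset" where
  "G_list sc \<alpha> [] P = (Base ` fst P, Base ` snd P)"
| "G_list sc \<alpha> (a # as) P =
     (if a \<in> \<alpha> then brace sc (G_list sc (\<alpha> - {a}) as P) else times_K (G_list sc \<alpha> as P))"

definition G :: "('v::ab_group_add \<Rightarrow> 'k::{ring,monoid_mult} \<Rightarrow> 'v) \<Rightarrow> nat set \<Rightarrow> nat set \<Rightarrow>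
    'v lset \<Rightarrow> ('v, 'k) vertex set" where
  "G sc \<alpha> N P = fst (G_list sc \<alpha> (desc N) P)"

definition cube :: "('v::ab_group_add \<Rightarrow> 'k::{ring,monoid_mult} \<Rightarrow> 'v) \<Rightarrow> nat set \<Rightarrow>
    'v lset \<Rightarrow> ('v, 'k) vertex set" where
  "cube sc A P = G sc A A P"

text \<open>Affine coordinates \<open>v\<^sub>\<gamma>\<close> and \<open>t\<^sub>\<gamma>\<close>, for the list of steps \<open>[a\<^sub>n, \<dots>, a\<^sub>1]\<close>. They are
  \<^const>\<open>undefined\<close> at every \<open>\<gamma>\<close> that does not label a coordinate, as for \<^const>\<open>restrict\<close>.\<close>

fun v_list :: "nat list \<Rightarrow> ('v, 'k) vertex \<Rightarrow> nat set \<Rightarrow> 'v" where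
  "v_list [] (Base u) \<gamma> = (if \<gamma> = {} then u else undefined)"
| "v_list (a # as) (Ext x t) \<gamma> = v_list as x \<gamma>"
| "v_list (a # as) (Tri x v t) \<gamma> = (if a \<in> \<gamma> then v_list as v (\<gamma> - {a}) else v_list as x \<gamma>)"
| "v_list _ _ _ = undefined"

fun t_list :: "nat list \<Rightarrow> ('v, 'k) vertex \<Rightarrow> nat set \<Rightarrow> 'k" where
  "t_list [] (Base u) \<gamma> = undefined"
| "t_list (a # as) (Ext x t) \<gamma> = (if \<gamma> = {a} then t else t_list as x \<gamma>)"
| "t_list (a # as) (Tri x v t) \<gamma> =
     (if \<gamma> = {a} then t else if a \<in> \<gamma> then t_list as v (\<gamma> - {a}) else t_list as x \<gamma>)"
| "t_list _ _ _ = undefined"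

definition v_coord :: "nat set \<Rightarrow> ('v, 'k) vertex \<Rightarrow> nat set \<Rightarrow> 'v" where
  "v_coord N x = v_list (desc N) x"

definition t_coord :: "nat set \<Rightarrow> ('v, 'k) vertex \<Rightarrow> nat set \<Rightarrow> 'k" where
  "t_coord N x = t_list (desc N) x"

text \<open>\<open>U\<^sup>A\<close> and \<open>0\<^sup>A\<close> in affine coordinates; the latter keeps only the \<open>t\<^sub>\<gamma>\<close>.\<close>

definition cube_coords :: "('v::ab_group_add \<Rightarrow> 'k::{ring,monoid_mult} \<Rightarrow> 'v) \<Rightarrow> nat set \<Rightarrow>
    'v lset \<Rightarrow> ((nat set \<Rightarrow> 'v) \<times> (nat set \<Rightarrow> 'k)) set" where
  "cube_coords sc A P = (\<lambda>x. (v_coord A x, t_coord A x)) ` cube sc A P"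

definition zero_cube_coords :: "('v::ab_group_add \<Rightarrow> 'k::{ring,monoid_mult} \<Rightarrow> 'v) \<Rightarrow> nat set \<Rightarrow>
    (nat set \<Rightarrow> 'k) set" where
  "zero_cube_coords sc A = t_coord A ` cube sc A zero_lset"

text \<open>The canonical map \<open>0\<^sup>A \<rightarrow> 0\<^sup>B\<close> for \<open>B \<subseteq> A\<close>. The map \<open>U\<^sup>A \<rightarrow> 0\<^sup>A\<close> is the second projection
  of \<open>(v, t)\<close>.\<close>

definition to_zero :: "nat set \<Rightarrow> (nat set \<Rightarrow> 'k) \<Rightarrow> nat set \<Rightarrow> 'k" where
  "to_zero B t = restrict t (Pow B - {{}})"

text \<open>The sets of the stair, counted from \<open>0\<close>: \<open>stair \<alpha> N i\<close> is \<open>S\<^sub>i\<^sub>+\<^sub>1\<close>.\<close>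

definition stair :: "nat set \<Rightarrow> nat set \<Rightarrow> nat \<Rightarrow> nat set" where
  "stair \<alpha> N i =
     {sorted_list_of_set N ! i} \<union> (\<alpha> - set (take i (sorted_list_of_set N)))"

lemma stair_alt:
  assumes "finite N" "\<alpha> \<subseteq> N" "i < card N"
  shows "stair \<alpha> N i = {sorted_list_of_set N ! j | j. j < card N \<and>
           (j = i \<or> (j > i \<and> sorted_list_of_set N ! j \<in> \<alpha>))}"
proof -
  define L where "L = sorted_list_of_set N"
  have L: "set L = N" "distinct L" "length L = card N"
    using assms(1) by (simp_all add: L_def)
  have *: "L ! j \<in> set (take i L) \<longleftrightarrow> j < i" if "j < card N" for j
    using that L assms(3) by (auto simp: in_set_conv_nth nth_eq_iff_index_eq)
  have "{L ! i} \<union> (\<alpha> - set (take i L)) =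
      {L ! j | j. j < card N \<and> (j = i \<or> (j > i \<and> L ! j \<in> \<alpha>))}" (is "?l = ?r")
  proof (intro equalityI subsetI)
    fix b assume b: "b \<in> ?l"
    show "b \<in> ?r"
    proof (cases "b = L ! i")
      case False
      then have "b \<in> \<alpha>" "b \<notin> set (take i L)" using b by auto
      then obtain j where j: "j < card N" "b = L ! j"
        using assms(2) L by (metis in_set_conv_nth subsetD)
      then have "j > i" using * \<open>b \<notin> _\<close> False by (metis linorder_neqE_nat)
      then show ?thesis using j \<open>b \<in> \<alpha>\<close> by blast
    qed (use assms(3) in blast)
  qed (use * in auto)
  then show ?thesis by (simp add: stair_def L_def)
qed

text \<open>The fibre product
  \<open>U\<^sup>\<alpha> \<times>\<^sub>B 0\<^sup>S\<^sup>1 \<times> 0\<^sup>S\<^sup>2 \<times> \<dots> \<times> 0\<^sup>S\<^sup>n\<close>, the first product over \<open>0\<^sup>B\<close>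
  and the following ones over the \<open>0\<close>-cubes of \<open>S\<^sub>i \<inter> S\<^sub>i\<^sub>+\<^sub>1\<close>:
  tuples \<open>((v, t), [s\<^sub>1, \<dots>, s\<^sub>n])\<close> whose neighbours have equal images in the base between them.\<close>

definition stair_product :: "('v::ab_group_add \<Rightarrow> 'k::{ring,monoid_mult} \<Rightarrow> 'v) \<Rightarrow>
    nat set \<Rightarrow> nat set \<Rightarrow> nat set \<Rightarrow> 'v lset \<Rightarrow>
    (((nat set \<Rightarrow> 'v) \<times> (nat set \<Rightarrow> 'k)) \<times> (nat set \<Rightarrow> 'k) list) set" where
  "stair_product sc \<alpha> N B P =
     {((v, t), s). (v, t) \<in> cube_coords sc \<alpha> P \<and> length s = card N \<and>
        (\<forall>i < card N. s ! i \<in> zero_cube_coords sc (stair \<alpha> N i)) \<and>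
        (0 < card N \<longrightarrow> to_zero B t = to_zero B (s ! 0)) \<and>
        (\<forall>i. Suc i < card N \<longrightarrow>
           to_zero (stair \<alpha> N i \<inter> stair \<alpha> N (Suc i)) (s ! i) =
           to_zero (stair \<alpha> N i \<inter> stair \<alpha> N (Suc i)) (s ! Suc i))}"

text \<open>Identification of coordinates: entries of different factors with the same label \<open>\<gamma>\<close> are one
  coordinate \<open>\<tau>\<^sub>\<gamma>\<close>. For the base \<open>B = \<alpha> - {a\<^sub>1}\<close> this is automatic on \<^const>\<open>stair_product\<close> if
  \<open>a\<^sub>1 \<notin> \<alpha>\<close>. If \<open>a\<^sub>1 \<in> \<alpha>\<close>, then \<open>S\<^sub>1 = \<alpha>\<close>, and the \<open>t\<^sub>\<gamma>\<close> with \<open>a\<^sub>1 \<in> \<gamma> \<subseteq> \<alpha>\<close> occur both in \<open>U\<^sup>\<alpha>\<close> and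
  in the factor of \<open>S\<^sub>1\<close>, but not in the base; only this identification makes them equal.\<close>

definition coords_identified :: "nat set \<Rightarrow> nat set \<Rightarrow>
    ((nat set \<Rightarrow> 'v) \<times> (nat set \<Rightarrow> 'k)) \<times> (nat set \<Rightarrow> 'k) list \<Rightarrow> bool" where
  "coords_identified \<alpha> N = (\<lambda>((v, t), s).
     \<exists>\<tau>. t = to_zero \<alpha> \<tau> \<and> (\<forall>i < card N. s ! i = to_zero (stair \<alpha> N i) \<tau>))"

definition stair_map :: "nat set \<Rightarrow> nat set \<Rightarrow> ('v, 'k) vertex \<Rightarrow>
    ((nat set \<Rightarrow> 'v) \<times> (nat set \<Rightarrow> 'k)) \<times> (nat set \<Rightarrow> 'k) list" where
  "stair_map \<alpha> N x =
     ((restrict (v_coord N x) (Pow \<alpha>), to_zero \<alpha> (t_coord N x)),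
      map (\<lambda>i. to_zero (stair \<alpha> N i) (t_coord N x)) [0..<card N])"

end

(* In affine coordinates the ambient module of G^{alpha;N} U is free on its labels: v_gamma for
   gamma a subset of alpha, and t_gamma for nonempty gamma contained in some S_i. Forgetting the
   coordinates introduced by the factors K is linear on each step, so that membership in
   G^{alpha;N} U only depends on the resulting vertex, which carries the coordinates labelled by
   subsets of alpha and has to lie in U^alpha. The factors 0^{S_i} impose no condition and merely
   supply the remaining t_gamma. If a_1 is not in alpha, a label common to two factors belongs to
   every factor in between, hence the neighbour conditions already identify its two entries. *)

theory Submission
  imports Defs
begin

section \<open>Ambient modules and their closure properties\<close>

text \<open>Additivity gives \<open>sc 0 t = sc 0 t + sc 0 t\<close>, hence
  \<open>sc 0 t = 0\<close>. This makes \<open>zero_lset\<close> a linear set for the same scalar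
  action as the given one.\<close>

lemma right_module_zero:
  assumes "right_module V sc"
  shows "right_module {0} sc"
proof -
  interpret right_module V sc by fact
  have "sc 0 t = 0" for t
    using sc_add_left[OF zero_closed zero_closed, of t] by simp
  then show ?thesis
    by unfold_locales auto
qed

lemma fst_brace:
  "fst (brace sc Q) =
     {Tri x v t | x v t. x \<in> snd Q \<and> v \<in> snd Q \<and> x \<in> fst Q \<and> vadd x (vscale sc v t) \<in> fst Q}"
  by (simp add: brace_def case_prod_beta)

lemma snd_brace: "snd (brace sc Q) = {Tri x v t | x v t. x \<in> snd Q \<and> v \<in> snd Q}"
  by (simp add: brace_def case_prod_beta)

lemma fst_times_K: "fst (times_K Q) = {Ext x t | x t. x \<in> fst Q}"
  by (simp add: times_K_def case_prod_beta)

lemma snd_times_K: "snd (times_K Q) = {Ext x t | x t. x \<in> snd Q}"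
  by (simp add: times_K_def case_prod_beta)

lemmas lset_simps = fst_brace snd_brace fst_times_K snd_times_K

lemma fst_G_list_subset:
  assumes "fst P \<subseteq> snd P"
  shows "fst (G_list sc \<alpha> as P) \<subseteq> snd (G_list sc \<alpha> as P)"
proof (induction as arbitrary: \<alpha>)
  case Nil
  show ?case using assms by auto
next
  case (Cons a as)
  then show ?case by (fastforce simp: lset_simps)
qed

lemma vadd_closed:
  assumes "right_module (snd P) sc"
    and "x \<in> snd (G_list sc \<alpha> as P)" "y \<in> snd (G_list sc \<alpha> as P)"
  shows "vadd x y \<in> snd (G_list sc \<alpha> as P)"
  using assms(2,3)
proof (induction as arbitrary: \<alpha> x y)
  case Nil
  then show ?case using right_module.add_closed[OF assms(1)] by auto
next
  case (Cons a as)
  then show ?case by (auto simp: lset_simps split: if_splits)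
qed

lemma vscale_closed:
  assumes "right_module (snd P) sc" and "x \<in> snd (G_list sc \<alpha> as P)"
  shows "vscale sc x s \<in> snd (G_list sc \<alpha> as P)"
  using assms(2)
proof (induction as arbitrary: \<alpha> x)
  case Nil
  then show ?case using right_module.sc_closed[OF assms(1)] by auto
next
  case (Cons a as)
  then show ?case by (auto simp: lset_simps split: if_splits)
qed

text \<open>If the subset is the whole module, the condition on
  \<open>vadd x (vscale sc v t)\<close> in \<open>brace\<close> follows from closure at every step.
  The case of interest is \<open>zero_lset\<close>.\<close>

lemma G_list_full:
  assumes "right_module (snd P) sc" and "fst P = snd P"
  shows "fst (G_list sc \<alpha> as P) = snd (G_list sc \<alpha> as P)"
proof (induction as arbitrary: \<alpha>)
  case Nil
  show ?case using assms(2) by simp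
next
  case (Cons a as)
  then show ?case
    using vadd_closed[OF assms(1)] vscale_closed[OF assms(1)] by (auto simp: lset_simps)
qed

section \<open>Forgetting the factors K\<close>

text \<open>The projection from the vertices of shape (\<alpha>, N) to the cube vertices of shape
  \<alpha>. It descends into both components of a triple, since each carries its own copy of the
  scalars added at earlier steps.\<close>

fun strip :: "('v, 'k) vertex \<Rightarrow> ('v, 'k) vertex" where
  "strip (Base u) = Base u"
| "strip (Ext x t) = strip x"
| "strip (Tri x v t) = Tri (strip x) (strip v) t"

lemma strip_vscale: "strip (vscale sc x s) = vscale sc (strip x) s"
  by (induction x) auto

text \<open>Lying in one ambient module forces equal shapes; on unequal shapes \<open>vadd\<close>
  is \<open>undefined\<close> and an equation of this kind could not be expected.\<close>

lemma strip_vadd: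
  assumes "x \<in> snd (G_list sc \<alpha> as P)" "y \<in> snd (G_list sc \<alpha> as P)"
  shows "strip (vadd x y) = vadd (strip x) (strip y)"
  using assms
proof (induction as arbitrary: \<alpha> x y)
  case (Cons a as)
  then show ?case by (auto simp: lset_simps split: if_splits)
qed auto

text \<open>A \<open>brace\<close> step removes \<open>a\<close> from \<alpha> in the recursion of
  \<open>G_list\<close>. As \<open>a\<close> does not recur among the remaining steps, the induction
  hypothesis still speaks of the same filtered list.\<close>

lemma filter_mem_remove1:
  assumes "a \<notin> set as"
  shows "filter (\<lambda>b. b \<in> \<alpha> - {a}) as = filter (\<lambda>b. b \<in> \<alpha>) as"
  using assms by (intro filter_cong) auto

lemma strip_ambient:
  assumes "x \<in> snd (G_list sc \<alpha> as P)" and "distinct as"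
  shows "strip x \<in> snd (G_list sc \<alpha> (filter (\<lambda>b. b \<in> \<alpha>) as) P)"
  using assms
proof (induction as arbitrary: \<alpha> x)
  case (Cons a as)
  then show ?case
    using Cons.IH[of _ "\<alpha> - {a}"] filter_mem_remove1[of a as \<alpha>]
    by (auto simp: lset_simps split: if_splits)
qed auto

text \<open>A \<open>times_K\<close> step adds no condition. At a \<open>brace\<close> step the
  condition concerns \<open>y\<close> and the vertex displaced along \<open>v\<close>;
  \<open>strip\<close> commutes with the displacement, so the induction hypothesis applies to
  both.\<close>

lemma G_list_iff_strip:
  assumes "right_module (snd P) sc" "fst P \<subseteq> snd P"
    and "x \<in> snd (G_list sc \<alpha> as P)" and "distinct as"
  shows "x \<in> fst (G_list sc \<alpha> as P) \<longleftrightarrow> strip x \<in> fst (G_list sc \<alpha> (filter (\<lambda>b. b \<in> \<alpha>) as) P)"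
  using assms(3,4)
proof (induction as arbitrary: \<alpha> x)
  case Nil
  then show ?case by auto
next
  case (Cons a as)
  show ?case
  proof (cases "a \<in> \<alpha>")
    case True
    let ?E = "snd (G_list sc (\<alpha> - {a}) as P)"
    obtain y v t where x: "x = Tri y v t" "y \<in> ?E" "v \<in> ?E"
      using Cons.prems True by (auto simp: lset_simps)
    have d: "distinct as" "a \<notin> set as" using Cons.prems by auto
    \<comment> \<open>The induction hypothesis holds for ambient vertices only, so the displaced
      vertex is first placed in \<open>?E\<close>.\<close>
    have "vadd y (vscale sc v t) \<in> ?E"
      using x vadd_closed vscale_closed assms(1) by blast
    moreover have "strip (vadd y (vscale sc v t)) = vadd (strip y) (vscale sc (strip v) t)"
      using strip_vadd[OF x(2) vscale_closed[OF assms(1) x(3)]] by (simp add: strip_vscale)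
    ultimately show ?thesis
      using x True d Cons.IH[of _ "\<alpha> - {a}"] strip_ambient[OF x(2) d(1)]
        strip_ambient[OF x(3) d(1)] filter_mem_remove1[of a as \<alpha>]
      by (auto simp: lset_simps)
  next
    case False
    then show ?thesis using Cons by (auto simp: lset_simps)
  qed
qed

lemma v_list_strip:
  assumes "x \<in> snd (G_list sc \<alpha> as P)" and "distinct as"
  shows "v_list (filter (\<lambda>b. b \<in> \<alpha>) as) (strip x) \<gamma> = v_list as x \<gamma>"
  using assms
proof (induction as arbitrary: \<alpha> x \<gamma>)
  case (Cons a as)
  then show ?case
    using Cons.IH[of _ "\<alpha> - {a}"] filter_mem_remove1[of a as \<alpha>]
    by (auto simp: lset_simps split: if_splits)
qed auto

text \<open>Every deleted scalar has a label that contains a step outside \<alpha>: it starts as a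
  singleton \<open>{a}\<close> with \<open>a\<close> not in \<alpha>, and later steps only enlarge
  it. Labels inside \<alpha> therefore keep their scalars.\<close>

lemma t_list_strip:
  assumes "x \<in> snd (G_list sc \<alpha> as P)" and "distinct as" and "\<gamma> \<subseteq> \<alpha>"
  shows "t_list (filter (\<lambda>b. b \<in> \<alpha>) as) (strip x) \<gamma> = t_list as x \<gamma>"
  using assms
proof (induction as arbitrary: \<alpha> x \<gamma>)
  case (Cons a as)
  show ?case
  proof (cases "a \<in> \<alpha>")
    case True
    have "\<gamma> - {a} \<subseteq> \<alpha> - {a}" "a \<notin> \<gamma> \<Longrightarrow> \<gamma> \<subseteq> \<alpha> - {a}" using Cons.prems by auto
    then show ?thesis
      using Cons.prems True Cons.IH[of _ "\<alpha> - {a}"] filter_mem_remove1[of a as \<alpha>]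
      by (auto simp: lset_simps)
  next
    case False
    then have "\<gamma> \<noteq> {a}" using Cons.prems by auto
    moreover obtain y t where "x = Ext y t" "y \<in> snd (G_list sc \<alpha> as P)"
      using Cons.prems False by (auto simp: lset_simps)
    ultimately show ?thesis using Cons False by simp
  qed
qed auto

section \<open>The labels of the scalar coordinates\<close>

text \<open>The set \<open>insert b (\<alpha> \<inter> {b<..})\<close> is the stair set that starts
  at \<open>b\<close>. Naming it by its first element instead of an index suits inductions that add
  a new largest step.\<close>

definition t_labels :: "nat set \<Rightarrow> nat set \<Rightarrow> nat set set" where
  "t_labels \<alpha> N = {\<gamma>. \<gamma> \<noteq> {} \<and> (\<exists>b\<in>N. \<gamma> \<subseteq> insert b (\<alpha> \<inter> {b<..}))}"

lemma t_labels_empty: "t_labels \<alpha> {} = {}"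
  by (simp add: t_labels_def)

text \<open>For \<alpha> = A the stair sets are the final segments of A, and a nonempty \<gamma>
  lies in the one starting at its minimum.\<close>

lemma t_labels_self:
  assumes "finite A"
  shows "t_labels A A = Pow A - {{}}"
proof -
  have "\<exists>b\<in>A. \<gamma> \<subseteq> insert b (A \<inter> {b<..})" if "\<gamma> \<subseteq> A" "\<gamma> \<noteq> {}" for \<gamma>
  proof (rule bexI[of _ "Min \<gamma>"])
    have "finite \<gamma>" using that assms finite_subset by blast
    moreover from this have "Min \<gamma> \<in> \<gamma>" using that(2) by (rule Min_in)
    ultimately show "\<gamma> \<subseteq> insert (Min \<gamma>) (A \<inter> {Min \<gamma><..})"
      using that by (auto simp: order.strict_iff_order)
    show "Min \<gamma> \<in> A" using \<open>Min \<gamma> \<in> \<gamma>\<close> that by blast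
  qed
  then show ?thesis by (auto simp: t_labels_def)
qed

text \<open>All of \<alpha> lies below \<open>a\<close>, so the only new stair set is
  \<open>{a}\<close> and the earlier ones are unchanged.\<close>

lemma t_labels_insert_Ext:
  assumes "\<alpha> \<subseteq> N" and "\<And>b. b \<in> N \<Longrightarrow> b < a"
  shows "t_labels \<alpha> (insert a N) = insert {a} (t_labels \<alpha> N)"
proof -
  have "\<alpha> \<inter> {a<..} = {}" using assms by force
  then show ?thesis by (auto simp: t_labels_def)
qed

text \<open>Now \<open>a\<close> joins every earlier stair set, so each old label occurs without
  \<open>a\<close> (in the component x) and with \<open>a\<close> (in v). The label
  \<open>{a}\<close> of the new scalar is listed apart because removing \<open>a\<close> leaves the
  empty set, which is no label.\<close>

lemma t_labels_insert_Tri: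
  assumes "a \<in> \<alpha>" "\<alpha> \<subseteq> insert a N" and "\<And>b. b \<in> N \<Longrightarrow> b < a"
  shows "\<gamma> \<in> t_labels \<alpha> (insert a N) \<longleftrightarrow> \<gamma> = {a} \<or> \<gamma> - {a} \<in> t_labels (\<alpha> - {a}) N"
proof -
  have 1: "\<alpha> \<inter> {a<..} = {}" using assms by force
  have 2: "\<gamma> \<subseteq> insert b (\<alpha> \<inter> {b<..}) \<longleftrightarrow> \<gamma> - {a} \<subseteq> insert b ((\<alpha> - {a}) \<inter> {b<..})" if "b \<in> N" for b
    using assms(1) assms(3)[OF that] by auto
  show ?thesis
  proof (cases "\<gamma> \<subseteq> {a}")
    case True
    then have "\<gamma> = {} \<or> \<gamma> = {a}" by auto
    then show ?thesis by (auto simp: t_labels_def)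
  next
    case False
    then have "\<gamma> \<noteq> {}" "\<gamma> \<noteq> {a}" "\<gamma> - {a} \<noteq> {}" by auto
    with False show ?thesis unfolding t_labels_def using 1 2 by auto
  qed
qed

lemma notin_t_labels: "a \<in> \<gamma> \<Longrightarrow> a \<notin> \<alpha> \<Longrightarrow> a \<notin> N \<Longrightarrow> \<gamma> \<notin> t_labels \<alpha> N"
  by (auto simp: t_labels_def)

section \<open>Affine coordinates identify the ambient module with all families on the
  labels\<close>

lemma v_list_PiE:
  assumes "x \<in> snd (G_list sc \<alpha> as P)" and "\<alpha> \<subseteq> set as"
  shows "v_list as x \<in> Pow \<alpha> \<rightarrow>\<^sub>E snd P"
  using assms
proof (induction as arbitrary: \<alpha> x)
  case Nil
  then show ?case by (auto simp: PiE_iff extensional_def split: if_splits)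
next
  case (Cons a as)
  show ?case
  proof (cases "a \<in> \<alpha>")
    case True
    obtain y v t where x: "x = Tri y v t" "y \<in> snd (G_list sc (\<alpha> - {a}) as P)"
        "v \<in> snd (G_list sc (\<alpha> - {a}) as P)"
      using Cons.prems True by (auto simp: lset_simps)
    have s: "\<alpha> - {a} \<subseteq> set as" using Cons.prems by auto
    note I = Cons.IH[OF x(2) s] Cons.IH[OF x(3) s]
    show ?thesis
    proof (rule PiE_I)
      fix \<gamma> assume "\<gamma> \<in> Pow \<alpha>"
      then have "\<gamma> - {a} \<in> Pow (\<alpha> - {a})" "a \<notin> \<gamma> \<Longrightarrow> \<gamma> \<in> Pow (\<alpha> - {a})" by auto
      then show "v_list (a # as) x \<gamma> \<in> snd P"
        using x(1) PiE_mem[OF I(1)] PiE_mem[OF I(2)] by auto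
    next
      fix \<gamma> assume "\<gamma> \<notin> Pow \<alpha>"
      then have "\<gamma> - {a} \<notin> Pow (\<alpha> - {a})" "\<gamma> \<notin> Pow (\<alpha> - {a})" using True by auto
      then show "v_list (a # as) x \<gamma> = undefined"
        using x(1) PiE_arb[OF I(1)] PiE_arb[OF I(2)] by auto
    qed
  next
    case False
    then have s: "\<alpha> \<subseteq> set as" using Cons.prems by auto
    obtain y t where x: "x = Ext y t" "y \<in> snd (G_list sc \<alpha> as P)"
      using Cons.prems False by (auto simp: lset_simps)
    have "v_list (a # as) x = v_list as y" using x by (simp add: fun_eq_iff)
    then show ?thesis using Cons.IH[OF x(2) s] by simp
  qed
qed

text \<open>Being \<open>undefined\<close> off the labels turns equality of coordinates into
  equality of functions. The descending order places each new step above the earlier ones, as the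
  recursions for \<open>t_labels\<close> require.\<close>

lemma t_list_extensional:
  assumes "x \<in> snd (G_list sc \<alpha> as P)" and "\<alpha> \<subseteq> set as" and "sorted_wrt (>) as"
  shows "t_list as x \<in> extensional (t_labels \<alpha> (set as))"
  using assms
proof (induction as arbitrary: \<alpha> x)
  case Nil
  then show ?case by (auto simp: extensional_def)
next
  case (Cons a as)
  have lt: "\<And>b. b \<in> set as \<Longrightarrow> b < a" using Cons.prems by auto
  show ?case
  proof (cases "a \<in> \<alpha>")
    case True
    obtain y v t where x: "x = Tri y v t" "y \<in> snd (G_list sc (\<alpha> - {a}) as P)"
        "v \<in> snd (G_list sc (\<alpha> - {a}) as P)"
      using Cons.prems True by (auto simp: lset_simps)
    have s: "\<alpha> - {a} \<subseteq> set as" "sorted_wrt (>) as" using Cons.prems by auto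
    note I = Cons.IH[OF x(2) s] Cons.IH[OF x(3) s]
    show ?thesis
      unfolding extensional_def mem_Collect_eq
    proof (intro allI impI)
      fix \<gamma> assume "\<gamma> \<notin> t_labels \<alpha> (set (a # as))"
      then have g: "\<gamma> \<noteq> {a}" "\<gamma> - {a} \<notin> t_labels (\<alpha> - {a}) (set as)"
        using t_labels_insert_Tri[of a \<alpha> "set as" \<gamma>] True Cons.prems lt by auto
      then have "a \<notin> \<gamma> \<Longrightarrow> \<gamma> \<notin> t_labels (\<alpha> - {a}) (set as)" by auto
      then show "t_list (a # as) x \<gamma> = undefined"
        using x(1) g extensional_arb[OF I(1)] extensional_arb[OF I(2)] by auto
    qed
  next
    case False
    then have s: "\<alpha> \<subseteq> set as" "sorted_wrt (>) as" using Cons.prems by auto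
    obtain y t where x: "x = Ext y t" "y \<in> snd (G_list sc \<alpha> as P)"
      using Cons.prems False by (auto simp: lset_simps)
    then show ?thesis
      using Cons.IH[OF x(2) s] t_labels_insert_Ext[OF s(1) lt] by (simp add: extensional_def)
  qed
qed

text \<open>At a \<open>brace\<close> step the sets without \<open>a\<close> give back the
  coordinates of x, those with \<open>a\<close> the coordinates of v, and \<open>{a}\<close> the
  scalar.\<close>

lemma coords_inj:
  assumes "x \<in> snd (G_list sc \<alpha> as P)" "y \<in> snd (G_list sc \<alpha> as P)"
    and "\<alpha> \<subseteq> set as" "sorted_wrt (>) as"
    and "v_list as x = v_list as y" "t_list as x = t_list as y"
  shows "x = y"
  using assms
proof (induction as arbitrary: \<alpha> x y)
  case Nil
  then obtain u w where "x = Base u" "y = Base w" by auto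
  then show ?case using fun_cong[OF Nil(5), of "{}"] by simp
next
  case (Cons a as)
  have lt: "\<And>b. b \<in> set as \<Longrightarrow> b < a" using Cons.prems by auto
  show ?case
  proof (cases "a \<in> \<alpha>")
    case True
    let ?E = "snd (G_list sc (\<alpha> - {a}) as P)"
    obtain x1 x2 t where x: "x = Tri x1 x2 t" "x1 \<in> ?E" "x2 \<in> ?E"
      using Cons.prems True by (auto simp: lset_simps)
    obtain y1 y2 u where y: "y = Tri y1 y2 u" "y1 \<in> ?E" "y2 \<in> ?E"
      using Cons.prems True by (auto simp: lset_simps)
    have s: "\<alpha> - {a} \<subseteq> set as" "sorted_wrt (>) as" using Cons.prems by auto
    \<comment> \<open>The coordinates of the triple show nothing of its components at sets
      containing \<open>a\<close>; there both sides have the default value.\<close>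
    have vu: "v_list as z \<gamma> = undefined" if "z \<in> ?E" "a \<in> \<gamma>" for z \<gamma>
      by (rule PiE_arb[OF v_list_PiE[OF that(1) s(1)]]) (use that in auto)
    \<comment> \<open>The empty set is included because \<open>insert a {}\<close> is the label of
      the new scalar and hides the value of the component v there.\<close>
    have tu: "t_list as z \<gamma> = undefined" if "z \<in> ?E" "a \<in> \<gamma> \<or> \<gamma> = {}" for z \<gamma>
      by (rule extensional_arb[OF t_list_extensional[OF that(1) s]])
        (use that notin_t_labels[of a \<gamma> "\<alpha> - {a}" "set as"] lt in \<open>auto simp: t_labels_def\<close>)
    have v: "v_list (a # as) x \<gamma> = v_list (a # as) y \<gamma>"
      and t: "t_list (a # as) x \<gamma> = t_list (a # as) y \<gamma>" for \<gamma>
      using Cons.prems by auto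
    have "v_list as x1 = v_list as y1"
    proof
      fix \<gamma> show "v_list as x1 \<gamma> = v_list as y1 \<gamma>"
        by (cases "a \<in> \<gamma>") (use v[of \<gamma>] x y vu in auto)
    qed
    moreover have "v_list as x2 = v_list as y2"
    proof
      fix \<gamma> show "v_list as x2 \<gamma> = v_list as y2 \<gamma>"
        by (cases "a \<in> \<gamma>") (use v[of "insert a \<gamma>"] x y vu in auto)
    qed
    moreover have "t_list as x1 = t_list as y1"
    proof
      fix \<gamma> show "t_list as x1 \<gamma> = t_list as y1 \<gamma>"
      proof (cases "a \<in> \<gamma>")
        case False
        then have "\<gamma> \<noteq> {a}" by auto
        then show ?thesis using t[of \<gamma>] x y False by simp
      qed (use x y tu in simp)
    qed
    moreover have "t_list as x2 = t_list as y2"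
    proof
      fix \<gamma> show "t_list as x2 \<gamma> = t_list as y2 \<gamma>"
      proof (cases "a \<in> \<gamma> \<or> \<gamma> = {}")
        case False
        then have "insert a \<gamma> \<noteq> {a}" by auto
        then show ?thesis using t[of "insert a \<gamma>"] x y False by simp
      qed (use x y tu in auto)
    qed
    moreover have "t = u" using t[of "{a}"] x y by simp
    ultimately show ?thesis using Cons.IH x y s by metis
  next
    case False
    then have s: "\<alpha> \<subseteq> set as" "sorted_wrt (>) as" using Cons.prems by auto
    obtain x1 t where x: "x = Ext x1 t" "x1 \<in> snd (G_list sc \<alpha> as P)"
      using Cons.prems False by (auto simp: lset_simps)
    obtain y1 u where y: "y = Ext y1 u" "y1 \<in> snd (G_list sc \<alpha> as P)"
      using Cons.prems False by (auto simp: lset_simps)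
    \<comment> \<open>At \<open>{a}\<close> the new scalar hides the value of the shorter vertex,
      which is the default on both sides.\<close>
    have tu: "t_list as z {a} = undefined" if "z \<in> snd (G_list sc \<alpha> as P)" for z
      by (rule extensional_arb[OF t_list_extensional[OF that s]])
        (use notin_t_labels[of a "{a}" \<alpha> "set as"] lt False in auto)
    have t: "t_list (a # as) x \<gamma> = t_list (a # as) y \<gamma>" for \<gamma>
      using Cons.prems by auto
    have "v_list as x1 = v_list as y1"
      using Cons.prems(5) x y by (auto simp: fun_eq_iff)
    moreover have "t_list as x1 = t_list as y1"
    proof
      fix \<gamma> show "t_list as x1 \<gamma> = t_list as y1 \<gamma>"
        by (cases "\<gamma> = {a}") (use t[of \<gamma>] x y tu in simp_all)
    qed
    moreover have "t = u" using t[of "{a}"] x y by simp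
    ultimately show ?thesis using Cons.IH x y s by metis
  qed
qed

text \<open>The coordinates are independent: a prescribed family splits into the families of the
  components and the new scalar, and the induction hypothesis realises each component.\<close>

lemma coords_surj:
  fixes sc :: "'v::ab_group_add \<Rightarrow> 'k::{ring,monoid_mult} \<Rightarrow> 'v"
  assumes "f \<in> Pow \<alpha> \<rightarrow>\<^sub>E snd P" "g \<in> extensional (t_labels \<alpha> (set as))"
    and "\<alpha> \<subseteq> set as" "sorted_wrt (>) as"
  shows "\<exists>x \<in> snd (G_list sc \<alpha> as P). v_list as x = f \<and> t_list as x = g"
  using assms
proof (induction as arbitrary: \<alpha> f g)
  case Nil
  let ?z = "Base (f {}) :: ('v, 'k) vertex"
  have "v_list [] ?z \<gamma> = f \<gamma>" for \<gamma>
    using Nil(3) PiE_arb[OF Nil(1), of \<gamma>] by (cases "\<gamma> = {}") simp_all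
  moreover have "t_list [] ?z \<gamma> = g \<gamma>" for \<gamma>
    using extensional_arb[OF Nil(2), of \<gamma>] by (simp add: t_labels_empty)
  moreover have "?z \<in> snd (G_list sc \<alpha> [] P)" using PiE_mem[OF Nil(1), of "{}"] by simp
  ultimately show ?case unfolding fun_eq_iff by blast
next
  case (Cons a as)
  have lt: "\<And>b. b \<in> set as \<Longrightarrow> b < a" using Cons.prems by auto
  show ?case
  proof (cases "a \<in> \<alpha>")
    case True
    let ?E = "snd (G_list sc (\<alpha> - {a}) as P)" and ?T = "t_labels (\<alpha> - {a}) (set as)"
    have s: "\<alpha> - {a} \<subseteq> set as" "sorted_wrt (>) as" using Cons.prems by auto
    have "restrict f (Pow (\<alpha> - {a})) \<in> Pow (\<alpha> - {a}) \<rightarrow>\<^sub>E snd P"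
      using Cons.prems(1) by (auto simp: PiE_iff)
    from Cons.IH[OF this restrict_extensional s, of g]
    obtain x where x: "x \<in> ?E" "v_list as x = restrict f (Pow (\<alpha> - {a}))"
        "t_list as x = restrict g ?T" by blast
    \<comment> \<open>The component v receives the values at the sets containing \<open>a\<close>,
      shifted so as to undo the passage from \<gamma> to \<open>\<gamma> - {a}\<close> in
      \<open>v_list\<close>.\<close>
    have "(\<lambda>\<gamma>\<in>Pow (\<alpha> - {a}). f (insert a \<gamma>)) \<in> Pow (\<alpha> - {a}) \<rightarrow>\<^sub>E snd P"
      using Cons.prems(1) True by (auto simp: PiE_iff)
    from Cons.IH[OF this restrict_extensional s, of "\<lambda>\<gamma>. g (insert a \<gamma>)"]
    obtain v where v: "v \<in> ?E" "v_list as v = (\<lambda>\<gamma>\<in>Pow (\<alpha> - {a}). f (insert a \<gamma>))"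
        "t_list as v = (\<lambda>\<gamma>\<in>?T. g (insert a \<gamma>))" by blast
    let ?z = "Tri x v (g {a})"
    have "v_list (a # as) ?z \<gamma> = f \<gamma>" for \<gamma>
    proof (cases "\<gamma> \<subseteq> \<alpha>")
      case True
      then have "\<gamma> - {a} \<subseteq> \<alpha> - {a}" "a \<notin> \<gamma> \<Longrightarrow> \<gamma> \<subseteq> \<alpha> - {a}" by auto
      then show ?thesis using x v by (cases "a \<in> \<gamma>") (simp_all add: insert_absorb)
    next
      case False
      then have "\<not> \<gamma> - {a} \<subseteq> \<alpha> - {a}" "\<not> \<gamma> \<subseteq> \<alpha> - {a}" using True by auto
      moreover have "f \<gamma> = undefined" using False PiE_arb[OF Cons.prems(1)] by simp
      ultimately show ?thesis using x v by simp
    qed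
    moreover have "t_list (a # as) ?z \<gamma> = g \<gamma>" for \<gamma>
    proof -
      have T: "\<gamma> \<in> t_labels \<alpha> (set (a # as)) \<longleftrightarrow> \<gamma> = {a} \<or> \<gamma> - {a} \<in> ?T"
        using t_labels_insert_Tri[of a \<alpha> "set as" \<gamma>] True Cons.prems lt by simp
      consider "\<gamma> = {a}" | "\<gamma> \<noteq> {a}" "a \<in> \<gamma>" | "\<gamma> \<noteq> {a}" "a \<notin> \<gamma>" by blast
      then show ?thesis
      proof cases
        case 2
        then show ?thesis
          using x v T extensional_arb[OF Cons.prems(2), of \<gamma>]
          by (cases "\<gamma> - {a} \<in> ?T") (simp_all add: insert_absorb)
      next
        case 3
        then show ?thesis
          using x v T extensional_arb[OF Cons.prems(2), of \<gamma>]
          by (cases "\<gamma> \<in> ?T") simp_all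
      qed simp
    qed
    moreover have "?z \<in> snd (G_list sc \<alpha> (a # as) P)"
      using x v True by (simp add: lset_simps)
    ultimately show ?thesis unfolding fun_eq_iff by blast
  next
    case False
    let ?T = "t_labels \<alpha> (set as)"
    have s: "\<alpha> \<subseteq> set as" "sorted_wrt (>) as" using Cons.prems False by auto
    have T: "t_labels \<alpha> (set (a # as)) = insert {a} ?T"
      using t_labels_insert_Ext[OF s(1) lt] by simp
    obtain x where x: "x \<in> snd (G_list sc \<alpha> as P)" "v_list as x = f" "t_list as x = restrict g ?T"
      using Cons.IH[OF Cons.prems(1) restrict_extensional s, of g] by blast
    let ?z = "Ext x (g {a})"
    have "t_list (a # as) ?z \<gamma> = g \<gamma>" for \<gamma>
      using x T extensional_arb[OF Cons.prems(2), of \<gamma>]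
      by (cases "\<gamma> = {a}"; cases "\<gamma> \<in> ?T") simp_all
    moreover have "v_list (a # as) ?z \<gamma> = f \<gamma>" for \<gamma> using x by simp
    moreover have "?z \<in> snd (G_list sc \<alpha> (a # as) P)"
      using x False by (simp add: lset_simps)
    ultimately show ?thesis unfolding fun_eq_iff by blast
  qed
qed

section \<open>Cubes over subsets, and the cubes of the point\<close>

lemma set_desc: "finite N \<Longrightarrow> set (desc N) = N"
  by (simp add: desc_def)

lemma sorted_desc: "sorted_wrt (>) (desc N)"
  by (simp add: desc_def sorted_wrt_rev)

lemma distinct_desc: "distinct (desc N)"
  by (simp add: desc_def)

text \<open>Strictly sorted lists are determined by their sets. Hence the steps that survive the
  filter in \<open>strip_ambient\<close> are exactly those of the cube over \<alpha>.\<close>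

lemma desc_subset:
  assumes "finite N" "\<alpha> \<subseteq> N"
  shows "desc \<alpha> = filter (\<lambda>b. b \<in> \<alpha>) (desc N)"
proof -
  have "finite \<alpha>" using assms finite_subset by blast
  then have "sorted_list_of_set \<alpha> = filter (\<lambda>b. b \<in> \<alpha>) (sorted_list_of_set N)"
    using assms by (intro sorted_distinct_set_unique) (auto intro: sorted_wrt_filter)
  then show ?thesis by (simp add: desc_def rev_filter)
qed

text \<open>For the point the cube is its whole ambient module, so its scalars range over all
  families on the nonempty subsets of A.\<close>

lemma zero_cube_coords_eq:
  fixes sc :: "'v::ab_group_add \<Rightarrow> 'k::{ring,monoid_mult} \<Rightarrow> 'v"
  assumes "right_module {0} sc" and "finite A"
  shows "zero_cube_coords sc A = extensional (Pow A - {{}})"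
proof -
  let ?E = "snd (G_list sc A (desc A) zero_lset)"
  have s: "A \<subseteq> set (desc A)" "sorted_wrt (>) (desc A)"
    using assms by (auto simp: set_desc sorted_desc)
  have T: "t_labels A (set (desc A)) = Pow A - {{}}"
    using assms by (simp add: set_desc t_labels_self)
  have "zero_cube_coords sc A = t_list (desc A) ` ?E"
    using G_list_full[of zero_lset sc A "desc A"] assms(1)
    by (simp add: zero_cube_coords_def cube_def G_def t_coord_def zero_lset_def)
  also have "\<dots> = extensional (Pow A - {{}})"
  proof (intro equalityI subsetI)
    fix g :: "nat set \<Rightarrow> 'k" assume g: "g \<in> extensional (Pow A - {{}})"
    \<comment> \<open>The module coordinates of the point can only be zero; this is the family to be
      prescribed along with \<open>g\<close>.\<close>
    have "(\<lambda>\<gamma>\<in>Pow A. 0) \<in> Pow A \<rightarrow>\<^sub>E snd (zero_lset :: 'v lset)"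
      by (auto simp: zero_lset_def)
    from coords_surj[OF this _ s, of g sc] show "g \<in> t_list (desc A) ` ?E"
      using g unfolding T by blast
  next
    fix g assume "g \<in> t_list (desc A) ` ?E"
    then obtain x where "x \<in> ?E" "g = t_list (desc A) x" by blast
    then show "g \<in> extensional (Pow A - {{}})"
      using t_list_extensional[OF _ s] unfolding T by simp
  qed
  finally show ?thesis .
qed

lemma to_zero_to_zero: "to_zero B (to_zero A t) = to_zero (A \<inter> B) t"
proof -
  have "(Pow A - {{}}) \<inter> (Pow B - {{}}) = Pow (A \<inter> B) - {{}}" by auto
  then show ?thesis by (simp add: to_zero_def)
qed

lemma to_zero_eqD: "to_zero B s = to_zero B t \<Longrightarrow> \<gamma> \<subseteq> B \<Longrightarrow> \<gamma> \<noteq> {} \<Longrightarrow> s \<gamma> = t \<gamma>"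
  by (drule fun_cong[of _ _ \<gamma>]) (simp add: to_zero_def)

section \<open>Combinatorics of the stair\<close>

lemma take_sorted_list_of_set:
  assumes "i < card N"
  shows "set (take i (sorted_list_of_set N)) = {b \<in> N. b < sorted_list_of_set N ! i}"
proof -
  have fin: "finite N" using assms card.infinite by fastforce
  let ?L = "sorted_list_of_set N"
  have L: "sorted_wrt (<) ?L" "length ?L = card N" "set ?L = N" using fin by auto
  have *: "?L ! j < ?L ! i \<longleftrightarrow> j < i" if "j < card N" for j
    using sorted_wrt_nth_less[OF L(1), of i j] sorted_wrt_nth_less[OF L(1), of j i] that assms L(2)
    by (cases i j rule: linorder_cases) auto
  show ?thesis
  proof (intro equalityI subsetI)
    fix b assume b: "b \<in> set (take i ?L)"
    then have "b \<in> N" using set_take_subset[of i ?L] L(3) by blast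
    moreover have "b < ?L ! i" using b * L(2) assms by (auto simp: in_set_conv_nth)
    ultimately show "b \<in> {b \<in> N. b < ?L ! i}" by simp
  next
    fix b assume b: "b \<in> {b \<in> N. b < ?L ! i}"
    then have "b \<in> set ?L" using L(3) by blast
    then obtain j where "j < card N" "b = ?L ! j" unfolding in_set_conv_nth L(2) by blast
    with b * show "b \<in> set (take i ?L)" using assms L(2) by (auto simp: in_set_conv_nth)
  qed
qed

text \<open>Positions before \<open>i\<close> hold precisely the elements of N below the one at
  \<open>i\<close>. This form matches the stair sets in \<open>t_labels\<close>.\<close>

lemma stair_eq:
  assumes "\<alpha> \<subseteq> N" "i < card N"
  shows "stair \<alpha> N i =
    insert (sorted_list_of_set N ! i) (\<alpha> \<inter> {sorted_list_of_set N ! i<..})"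
  using assms take_sorted_list_of_set[OF assms(2)] by (auto simp: stair_def)

lemma t_labels_eq_stairs:
  assumes "finite N" "\<alpha> \<subseteq> N"
  shows "t_labels \<alpha> N = (\<Union>i<card N. Pow (stair \<alpha> N i) - {{}})"
proof -
  let ?L = "sorted_list_of_set N"
  have N: "(\<lambda>i. ?L ! i) ` {..<card N} = N"
    using assms(1) nth_image[of "card N" ?L] by (simp add: atLeast0LessThan)
  have "t_labels \<alpha> N =
      {\<gamma>. \<gamma> \<noteq> {} \<and> (\<exists>b\<in>(\<lambda>i. ?L ! i) ` {..<card N}. \<gamma> \<subseteq> insert b (\<alpha> \<inter> {b<..}))}"
    by (simp only: N t_labels_def)
  also have "\<dots> = (\<Union>i<card N. Pow (stair \<alpha> N i) - {{}})"
    by (auto simp: stair_eq[OF assms(2)])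
  finally show ?thesis .
qed

text \<open>Every element of \<open>stair \<alpha> N j\<close> is at least the j-th element of N. It
  therefore exceeds the i-th one, so it can lie in \<open>stair \<alpha> N i\<close> only by
  belonging to \<alpha>; for k < j it also exceeds the k-th element and lies in
  \<open>stair \<alpha> N k\<close>.\<close>

lemma stair_between:
  assumes "\<alpha> \<subseteq> N" "i < k" "k \<le> j" "j < card N"
  shows "stair \<alpha> N i \<inter> stair \<alpha> N j \<subseteq> stair \<alpha> N k"
proof -
  let ?L = "sorted_list_of_set N"
  have fin: "finite N" using assms(4) card.infinite by fastforce
  have "sorted_wrt (<) ?L" "length ?L = card N" using fin by auto
  then have "?L ! i < ?L ! k" "k < j \<Longrightarrow> ?L ! k < ?L ! j"
    using assms by (auto intro: sorted_wrt_nth_less)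
  then show ?thesis using assms by (cases "k = j") (auto simp: stair_eq)
qed

lemma stair_chain:
  assumes "\<alpha> \<subseteq> N"
    and nb: "\<And>i. Suc i < card N \<Longrightarrow>
           to_zero (stair \<alpha> N i \<inter> stair \<alpha> N (Suc i)) (s ! i) =
           to_zero (stair \<alpha> N i \<inter> stair \<alpha> N (Suc i)) (s ! Suc i)"
    and "i \<le> j" "j < card N" and \<gamma>: "\<gamma> \<subseteq> stair \<alpha> N i" "\<gamma> \<subseteq> stair \<alpha> N j" "\<gamma> \<noteq> {}"
  shows "(s ! i) \<gamma> = (s ! j) \<gamma>"
proof -
  have in_between: "\<gamma> \<subseteq> stair \<alpha> N k" if "i \<le> k" "k \<le> j" for k
    using stair_between[OF assms(1) _ that(2) assms(4), of i] that \<gamma> by (cases "i = k") auto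
  have "(s ! i) \<gamma> = (s ! k) \<gamma>" if "i \<le> k" "k \<le> j" for k
    using that
  proof (induction k rule: dec_induct)
    case (step k)
    have "(s ! k) \<gamma> = (s ! Suc k) \<gamma>"
      using to_zero_eqD[OF nb] in_between[of k] in_between[of "Suc k"] step assms \<gamma>(3) by auto
    then show ?case using step by simp
  qed simp
  then show ?thesis using assms(3) by simp
qed

section \<open>Identification of equally labelled coordinates\<close>

text \<open>Here the base of the first fibre product is the cube over \<alpha> itself, so every
  coordinate of \<open>t\<close> reappears in the first stair factor; \<open>stair_chain\<close>
  carries it on to all others with that label.\<close>

lemma coords_identified_if_Min_notin:
  assumes "right_module {0} sc" "finite N" "\<alpha> \<subseteq> N" "Min N \<notin> \<alpha>"
    and p: "((v, t), s) \<in> stair_product sc \<alpha> N (\<alpha> - {Min N}) P"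
    and t_ext: "t \<in> extensional (Pow \<alpha> - {{}})"
  shows "coords_identified \<alpha> N ((v, t), s)"
proof -
  have B: "\<alpha> - {Min N} = \<alpha>" using assms(4) by auto
  have sext: "s ! i \<in> extensional (Pow (stair \<alpha> N i) - {{}})" if "i < card N" for i
  proof -
    have "finite (stair \<alpha> N i)"
      using assms finite_subset[OF assms(3,2)] by (simp add: stair_def)
    then show ?thesis using p that zero_cube_coords_eq[OF assms(1)] by (auto simp: stair_product_def)
  qed
  have st: "(s ! i) \<gamma> = (s ! j) \<gamma>"
    if "i < card N" "j < card N" "\<gamma> \<subseteq> stair \<alpha> N i" "\<gamma> \<subseteq> stair \<alpha> N j" "\<gamma> \<noteq> {}" for i j \<gamma>
  proof -
    have nb: "to_zero (stair \<alpha> N i \<inter> stair \<alpha> N (Suc i)) (s ! i) =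
           to_zero (stair \<alpha> N i \<inter> stair \<alpha> N (Suc i)) (s ! Suc i)" if "Suc i < card N" for i
      using p that by (auto simp: stair_product_def)
    show ?thesis
    proof (cases i j rule: le_cases)
      case le
      show ?thesis by (rule stair_chain[OF assms(3) nb le]) (use that in simp_all)
    next
      case ge
      show ?thesis by (rule stair_chain[OF assms(3) nb ge, symmetric]) (use that in simp_all)
    qed
  qed
  have ts: "t \<gamma> = (s ! i) \<gamma>" if "i < card N" "\<gamma> \<subseteq> \<alpha>" "\<gamma> \<subseteq> stair \<alpha> N i" "\<gamma> \<noteq> {}" for i \<gamma>
  proof -
    have 0: "0 < card N" "\<gamma> \<subseteq> stair \<alpha> N 0" using that by (auto simp: stair_def)
    then have "to_zero \<alpha> t = to_zero \<alpha> (s ! 0)" using p B by (auto simp: stair_product_def)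
    then have "t \<gamma> = (s ! 0) \<gamma>" using to_zero_eqD that by blast
    then show ?thesis using st[of 0 i \<gamma>] 0 that by simp
  qed
  \<comment> \<open>Labels inside \<alpha> take their value from \<open>t\<close>, all others from
    some stair factor that has them. The choice is immaterial by \<open>st\<close>, and consistent
    with \<open>t\<close> by \<open>ts\<close>.\<close>
  define \<tau> where "\<tau> \<gamma> = (if \<gamma> \<subseteq> \<alpha> then t \<gamma> else (s ! (SOME i. i < card N \<and> \<gamma> \<subseteq> stair \<alpha> N i)) \<gamma>)" for \<gamma>
  have "t = to_zero \<alpha> \<tau>"
    unfolding to_zero_def
    by (rule extensionalityI[OF t_ext]) (auto simp: \<tau>_def)
  moreover have "s ! i = to_zero (stair \<alpha> N i) \<tau>" if i: "i < card N" for i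
    unfolding to_zero_def
  proof (rule extensionalityI[OF sext[OF i]])
    fix \<gamma> assume g: "\<gamma> \<in> Pow (stair \<alpha> N i) - {{}}"
    let ?j = "SOME i. i < card N \<and> \<gamma> \<subseteq> stair \<alpha> N i"
    have "?j < card N \<and> \<gamma> \<subseteq> stair \<alpha> N ?j"
      by (rule someI[of _ i]) (use g i in auto)
    then show "(s ! i) \<gamma> = restrict \<tau> (Pow (stair \<alpha> N i) - {{}}) \<gamma>"
      using g i ts[of i \<gamma>] st[of i ?j \<gamma>] by (auto simp: \<tau>_def)
  qed auto
  ultimately show ?thesis by (auto simp: coords_identified_def)
qed

section \<open>The bijection with the stair product\<close>

lemma cube_coords_extensional:
  assumes "linear_set sc P" "finite A" "(v, t) \<in> cube_coords sc A P"
  shows "v \<in> Pow A \<rightarrow>\<^sub>E snd P" "t \<in> extensional (Pow A - {{}})"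
proof -
  obtain x where x: "x \<in> fst (G_list sc A (desc A) P)" "v = v_list (desc A) x" "t = t_list (desc A) x"
    using assms(3) by (auto simp: cube_coords_def cube_def G_def v_coord_def t_coord_def)
  have "fst P \<subseteq> snd P" using assms(1) by (simp add: linear_set_def)
  from fst_G_list_subset[OF this] have "x \<in> snd (G_list sc A (desc A) P)"
    using x(1) by blast
  then show "v \<in> Pow A \<rightarrow>\<^sub>E snd P" "t \<in> extensional (Pow A - {{}})"
    using x v_list_PiE[of x sc A "desc A" P] t_list_extensional[of x sc A "desc A" P] assms(2)
    by (auto simp: set_desc sorted_desc t_labels_self)
qed

text \<open>Injectivity: each scalar label lies in some stair set, so the image determines all
  coordinates. Surjectivity: the common family \<tau> and \<open>v\<close> are realised by an
  ambient vertex, and its stripped vertex is the given point of the cube over \<alpha>.\<close>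

lemma bij_betw_stair_map:
  fixes sc :: "'v::ab_group_add \<Rightarrow> 'k::{ring,monoid_mult} \<Rightarrow> 'v"
  assumes "linear_set sc P" "finite N" "\<alpha> \<subseteq> N"
  shows "bij_betw (stair_map \<alpha> N) (G sc \<alpha> N P)
           {p \<in> stair_product sc \<alpha> N (\<alpha> - {Min N}) P. coords_identified \<alpha> N p}"
    (is "bij_betw _ _ ?R")
proof -
  let ?as = "desc N" and ?E = "snd (G_list sc \<alpha> (desc N) P)" and ?E\<alpha> = "snd (G_list sc \<alpha> (desc \<alpha>) P)"
  have rm: "right_module (snd P) sc" "fst P \<subseteq> snd P" using assms(1) by (auto simp: linear_set_def)
  have z: "right_module {0} sc" using right_module_zero rm by blast
  have fin: "finite \<alpha>" using assms finite_subset by blast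
  have s: "\<alpha> \<subseteq> set ?as" "sorted_wrt (>) ?as" "distinct ?as" "set ?as = N"
    using assms by (auto simp: set_desc sorted_desc distinct_desc)
  have s\<alpha>: "\<alpha> \<subseteq> set (desc \<alpha>)" "sorted_wrt (>) (desc \<alpha>)" "set (desc \<alpha>) = \<alpha>"
    using fin by (auto simp: set_desc sorted_desc)
  have GE: "G sc \<alpha> N P = {x \<in> ?E. strip x \<in> cube sc \<alpha> P}"
    using G_list_iff_strip[OF rm _ s(3), of _ \<alpha>] fst_G_list_subset[OF rm(2), of sc \<alpha> ?as]
    unfolding G_def cube_def desc_subset[OF assms(2,3)] by blast
  have cubeE: "cube sc \<alpha> P \<subseteq> ?E\<alpha>"
    using fst_G_list_subset[OF rm(2)] by (simp add: G_def cube_def)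
  have stripE: "strip x \<in> ?E\<alpha>" if "x \<in> ?E" for x
    using strip_ambient[OF that s(3)] desc_subset[OF assms(2,3)] by simp
  have vstrip: "restrict (v_coord N x) (Pow \<alpha>) = v_coord \<alpha> (strip x)" if "x \<in> ?E" for x
  proof -
    have "v_coord \<alpha> (strip x) = v_coord N x"
      using v_list_strip[OF that s(3)] desc_subset[OF assms(2,3)] by (auto simp: v_coord_def)
    moreover have "v_coord N x \<in> extensional (Pow \<alpha>)"
      using v_list_PiE[OF that s(1)] by (auto simp: PiE_iff v_coord_def)
    ultimately show ?thesis by (simp add: extensional_restrict)
  qed
  have tstrip: "to_zero \<alpha> (t_coord N x) = t_coord \<alpha> (strip x)" if "x \<in> ?E" for x
    unfolding to_zero_def
  proof (rule extensionalityI[of _ "Pow \<alpha> - {{}}"])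
    show "t_coord \<alpha> (strip x) \<in> extensional (Pow \<alpha> - {{}})"
      using t_list_extensional[OF stripE[OF that] s\<alpha>(1,2)] s\<alpha>(3) t_labels_self[OF fin]
      by (simp add: t_coord_def)
    fix \<gamma> assume "\<gamma> \<in> Pow \<alpha> - {{}}"
    then show "restrict (t_coord N x) (Pow \<alpha> - {{}}) \<gamma> = t_coord \<alpha> (strip x) \<gamma>"
      using t_list_strip[OF that s(3), of \<gamma>] desc_subset[OF assms(2,3)] by (auto simp: t_coord_def)
  qed auto
  have labels: "t_labels \<alpha> N = (\<Union>i<card N. Pow (stair \<alpha> N i) - {{}})"
    by (rule t_labels_eq_stairs) fact+
  show ?thesis
    unfolding bij_betw_def
  proof (intro conjI inj_onI equalityI subsetI)
    fix x y assume xy: "x \<in> G sc \<alpha> N P" "y \<in> G sc \<alpha> N P" "stair_map \<alpha> N x = stair_map \<alpha> N y"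
    then have E: "x \<in> ?E" "y \<in> ?E" using GE by auto
    have "v_list ?as x = v_list ?as y"
    proof (rule extensionalityI[of _ "Pow \<alpha>"])
      fix \<gamma> assume "\<gamma> \<in> Pow \<alpha>"
      moreover have "restrict (v_coord N x) (Pow \<alpha>) \<gamma> = restrict (v_coord N y) (Pow \<alpha>) \<gamma>"
        using xy(3) by (simp add: stair_map_def)
      ultimately show "v_list ?as x \<gamma> = v_list ?as y \<gamma>" by (simp add: v_coord_def)
    qed (use v_list_PiE[OF E(1) s(1)] v_list_PiE[OF E(2) s(1)] in \<open>simp_all add: PiE_iff\<close>)
    moreover have "t_list ?as x = t_list ?as y"
    proof (rule extensionalityI[of _ "t_labels \<alpha> N"])
      fix \<gamma> assume "\<gamma> \<in> t_labels \<alpha> N"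
      then obtain i where i: "i < card N" "\<gamma> \<subseteq> stair \<alpha> N i" "\<gamma> \<noteq> {}"
        unfolding labels by blast
      then have "to_zero (stair \<alpha> N i) (t_coord N x) = to_zero (stair \<alpha> N i) (t_coord N y)"
        using xy(3) by (auto simp: stair_map_def)
      then show "t_list ?as x \<gamma> = t_list ?as y \<gamma>"
        using to_zero_eqD[OF _ i(2,3)] unfolding t_coord_def by blast
    qed (use t_list_extensional[OF E(1) s(1,2)] t_list_extensional[OF E(2) s(1,2)] s(4) in simp_all)
    ultimately show "x = y" by (rule coords_inj[OF E s(1,2)])
  next
    fix p assume "p \<in> stair_map \<alpha> N ` G sc \<alpha> N P"
    then obtain x where x: "x \<in> ?E" "strip x \<in> cube sc \<alpha> P" "p = stair_map \<alpha> N x"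
      using GE by auto
    have "(restrict (v_coord N x) (Pow \<alpha>), to_zero \<alpha> (t_coord N x)) \<in> cube_coords sc \<alpha> P"
      using x vstrip tstrip by (simp add: cube_coords_def)
    moreover have "to_zero (stair \<alpha> N i) (t_coord N x) \<in> zero_cube_coords sc (stair \<alpha> N i)" for i
    proof -
      have "finite (stair \<alpha> N i)" using fin by (simp add: stair_def)
      then show ?thesis using zero_cube_coords_eq[OF z] by (simp add: to_zero_def)
    qed
    moreover have "to_zero (\<alpha> - {Min N}) (to_zero \<alpha> \<tau>) =
        to_zero (\<alpha> - {Min N}) (to_zero (stair \<alpha> N 0) \<tau>)" for \<tau> :: "nat set \<Rightarrow> 'k"
    proof -
      \<comment> \<open>\<open>stair \<alpha> N 0\<close> contains \<alpha> whatever its first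
        element is; this covers empty N too, where \<open>Min N\<close> is unspecified.\<close>
      have "\<alpha> \<inter> (\<alpha> - {Min N}) = stair \<alpha> N 0 \<inter> (\<alpha> - {Min N})" by (auto simp: stair_def)
      then show ?thesis by (simp only: to_zero_to_zero)
    qed
    moreover have "to_zero (stair \<alpha> N i \<inter> stair \<alpha> N (Suc i)) (to_zero (stair \<alpha> N i) \<tau>) =
        to_zero (stair \<alpha> N i \<inter> stair \<alpha> N (Suc i)) (to_zero (stair \<alpha> N (Suc i)) \<tau>)"
      for i and \<tau> :: "nat set \<Rightarrow> 'k"
      by (simp add: to_zero_to_zero Int_commute Int_left_commute)
    ultimately have "p \<in> stair_product sc \<alpha> N (\<alpha> - {Min N}) P"
      unfolding x(3) by (simp add: stair_map_def stair_product_def)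
    moreover have "coords_identified \<alpha> N p"
      unfolding x(3) stair_map_def coords_identified_def by auto
    ultimately show "p \<in> ?R" by simp
  next
    fix p assume p: "p \<in> ?R"
    obtain v t l where pe: "p = ((v, t), l)" by (metis prod.collapse)
    obtain \<tau> where \<tau>: "t = to_zero \<alpha> \<tau>" "\<And>i. i < card N \<Longrightarrow> l ! i = to_zero (stair \<alpha> N i) \<tau>"
      using p pe by (auto simp: coords_identified_def)
    have c: "(v, t) \<in> cube_coords sc \<alpha> P" "length l = card N"
      using p pe by (auto simp: stair_product_def)
    then obtain y where y: "y \<in> cube sc \<alpha> P" "v = v_coord \<alpha> y" "t = t_coord \<alpha> y"
      by (auto simp: cube_coords_def)
    \<comment> \<open>Off the labels \<tau> is arbitrary; the restriction resets it to the default
      value there.\<close>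
    have "restrict \<tau> (t_labels \<alpha> N) \<in> extensional (t_labels \<alpha> (set ?as))"
      using s(4) by simp
    from coords_surj[OF cube_coords_extensional(1)[OF assms(1) fin c(1)] this s(1,2), of sc]
    obtain x where x: "x \<in> ?E" "v_list ?as x = v" "t_list ?as x = restrict \<tau> (t_labels \<alpha> N)"
      by blast
    have tz: "to_zero A (t_coord N x) = to_zero A \<tau>" if "Pow A - {{}} \<subseteq> t_labels \<alpha> N" for A
    proof -
      have "t_labels \<alpha> N \<inter> (Pow A - {{}}) = Pow A - {{}}" using that by auto
      then show ?thesis by (simp add: to_zero_def t_coord_def x(3))
    qed
    \<comment> \<open>The labels of \<open>t\<close> thus survive the restriction of \<tau>.\<close>
    have "t_labels \<alpha> \<alpha> \<subseteq> t_labels \<alpha> N"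
      using assms(3) unfolding t_labels_def by blast
    then have t: "to_zero \<alpha> (t_coord N x) = t"
      using tz[of \<alpha>] unfolding t_labels_self[OF fin] \<tau>(1) by simp
    have "v \<in> extensional (Pow \<alpha>)"
      using cube_coords_extensional(1)[OF assms(1) fin c(1)] by (simp add: PiE_iff)
    then have v: "restrict (v_coord N x) (Pow \<alpha>) = v"
      unfolding v_coord_def x(2) by (rule extensional_restrict)
    \<comment> \<open>\<open>x\<close> was built in the ambient module only. Its membership in the
      vertex set comes from \<open>y\<close> once both are seen to have the same
      coordinates.\<close>
    have "strip x = y"
    proof (rule coords_inj[OF stripE[OF x(1)] _ s\<alpha>(1,2)])
      show "y \<in> ?E\<alpha>" using cubeE y(1) by blast
      show "v_list (desc \<alpha>) (strip x) = v_list (desc \<alpha>) y"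
        using vstrip[OF x(1)] v y(2) unfolding v_coord_def by simp
      show "t_list (desc \<alpha>) (strip x) = t_list (desc \<alpha>) y"
        using tstrip[OF x(1)] t y(3) unfolding t_coord_def by simp
    qed
    then have "x \<in> G sc \<alpha> N P" using GE x(1) y(1) by simp
    moreover have "map (\<lambda>i. to_zero (stair \<alpha> N i) (t_coord N x)) [0..<card N] = l"
    proof (rule nth_equalityI)
      fix i assume "i < length (map (\<lambda>i. to_zero (stair \<alpha> N i) (t_coord N x)) [0..<card N])"
      then have i: "i < card N" by simp
      then have "Pow (stair \<alpha> N i) - {{}} \<subseteq> t_labels \<alpha> N" unfolding labels by blast
      then show "map (\<lambda>i. to_zero (stair \<alpha> N i) (t_coord N x)) [0..<card N] ! i = l ! i"
        using tz \<tau>(2) i by simp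
    qed (use c(2) in simp)
    then have "stair_map \<alpha> N x = p"
      by (simp add: stair_map_def pe t v)
    ultimately show "p \<in> stair_map \<alpha> N ` G sc \<alpha> N P" by blast
  qed
qed

lemma stair_product_identified:
  assumes "linear_set sc P" "finite N" "\<alpha> \<subseteq> N" "Min N \<notin> \<alpha>"
  shows "{p \<in> stair_product sc \<alpha> N (\<alpha> - {Min N}) P. coords_identified \<alpha> N p} =
    stair_product sc \<alpha> N (\<alpha> - {Min N}) P"
proof -
  have z: "right_module {0} sc"
    using right_module_zero assms(1) by (auto simp: linear_set_def)
  have fin: "finite \<alpha>" using assms finite_subset by blast
  have "coords_identified \<alpha> N p" if p: "p \<in> stair_product sc \<alpha> N (\<alpha> - {Min N}) P" for p
  proof -
    obtain v t s where pe: "p = ((v, t), s)" by (metis prod.collapse)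
    then have "(v, t) \<in> cube_coords sc \<alpha> P" using p by (simp add: stair_product_def)
    then show ?thesis
      using coords_identified_if_Min_notin[OF z assms(2-4) p[unfolded pe]]
        cube_coords_extensional(2)[OF assms(1) fin] pe by blast
  qed
  then show ?thesis by blast
qed

theorem theorem5p3:
  fixes sc :: "'v::ab_group_add \<Rightarrow> 'k::{ring,monoid_mult} \<Rightarrow> 'v"
    and U V :: "'v set" and N \<alpha> :: "nat set"
  assumes "linear_set sc (U, V)" and "finite N" and "\<alpha> \<subseteq> N"
  shows "(bij_betw (stair_map \<alpha> N) (G sc \<alpha> N (U, V))
            {p \<in> stair_product sc \<alpha> N (\<alpha> - {Min N}) (U, V). coords_identified \<alpha> N p} \<and>
          (Min N \<notin> \<alpha> \<longrightarrow> bij_betw (stair_map \<alpha> N) (G sc \<alpha> N (U, V))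
            (stair_product sc \<alpha> N (\<alpha> - {Min N}) (U, V)))) \<and>
         (bij_betw (stair_map \<alpha> N) (G sc \<alpha> N zero_lset)
            {p \<in> stair_product sc \<alpha> N (\<alpha> - {Min N}) zero_lset. coords_identified \<alpha> N p} \<and>
          (Min N \<notin> \<alpha> \<longrightarrow> bij_betw (stair_map \<alpha> N) (G sc \<alpha> N zero_lset)
            (stair_product sc \<alpha> N (\<alpha> - {Min N}) zero_lset)))"
proof -
  \<comment> \<open>An arbitrary linear set is treated, so that the point is covered as the instance
    \<open>zero_lset\<close>.\<close>
  have *: "bij_betw (stair_map \<alpha> N) (G sc \<alpha> N P)
            {p \<in> stair_product sc \<alpha> N (\<alpha> - {Min N}) P. coords_identified \<alpha> N p} \<and>
          (Min N \<notin> \<alpha> \<longrightarrow> bij_betw (stair_map \<alpha> N) (G sc \<alpha> N P)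
            (stair_product sc \<alpha> N (\<alpha> - {Min N}) P))" if P: "linear_set sc P" for P
  proof (intro conjI impI)
    note bij = bij_betw_stair_map[OF P assms(2,3)]
    then show "bij_betw (stair_map \<alpha> N) (G sc \<alpha> N P)
      {p \<in> stair_product sc \<alpha> N (\<alpha> - {Min N}) P. coords_identified \<alpha> N p}" .
    assume "Min N \<notin> \<alpha>"
    from bij[unfolded stair_product_identified[OF P assms(2,3) this]]
    show "bij_betw (stair_map \<alpha> N) (G sc \<alpha> N P) (stair_product sc \<alpha> N (\<alpha> - {Min N}) P)" .
  qed
  have "linear_set sc zero_lset"
    using assms(1) right_module_zero by (auto simp: linear_set_def zero_lset_def)
  then show ?thesis using *[OF assms(1)] * by blast
qed

end
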